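(* Let $G$ be a finite abelian group. Then the power graph $P(G)$ is a friendship graph if and only if $G\cong\mathbb{Z}_3^{\,n}$ for some positive integer $n$.
   Context: The power graph $P(G)$ of a finite group $G$ is the simple graph with vertex set $G$ in which two distinct vertices $u,v$ are adjacent if and only if $u\in\langle v\rangle$ or $v\in\langle u\rangle$. The friendship graph $F_m$ ($m\ge 1$) is $K_1\vee(mK_2)$: a single vertex joined to all vertices of $m$ disjoint copies of $K_2$. A graph is a friendship graph if it is isomorphic to $F_m$ for some $m\geq 1$. *)

theory Defs
  imports
    "HOL-Algebra.Elementary_Groups"
    "HOL-Algebra.Product_Groups"
    "Graph_Theory.Pair_Digraph"
    "Graph_Theory.Digraph_Isomorphism"
begin

text \<open>
  Following the convention of \<open>Graph_Theory\<close>, a finite simple graph is a symmetric loop-free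
  digraph without parallel arcs (locale \<open>pair_graph\<close>): an edge \<open>{u, v}\<close> is the pair of arcs
  \<open>(u, v)\<close>, \<open>(v, u)\<close>.
\<close>

definition power_graph :: "('a, 'b) monoid_scheme \<Rightarrow> 'a pair_pre_digraph" where
  "power_graph G =
    \<lparr> pverts = carrier G,
      parcs = {(u, v). u \<in> carrier G \<and> v \<in> carrier G \<and> u \<noteq> v \<and>
                       (u \<in> generate G {v} \<or> v \<in> generate G {u})} \<rparr>"

definition complete_graph_on :: "'a set \<Rightarrow> 'a pair_pre_digraph" where
  "complete_graph_on V = \<lparr> pverts = V, parcs = {(u, v). u \<in> V \<and> v \<in> V \<and> u \<noteq> v} \<rparr>"

definition disjoint_copies :: "nat \<Rightarrow> 'a pair_pre_digraph \<Rightarrow> (nat \<times> 'a) pair_pre_digraph" where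
  "disjoint_copies m H =
    \<lparr> pverts = {..<m} \<times> pverts H,
      parcs = {((i, u), (j, v)) | i j u v. i < m \<and> j = i \<and> (u, v) \<in> parcs H} \<rparr>"

definition graph_join ::
  "'a pair_pre_digraph \<Rightarrow> 'b pair_pre_digraph \<Rightarrow> ('a + 'b) pair_pre_digraph" where
  "graph_join H K =
    \<lparr> pverts = pverts H <+> pverts K,
      parcs = {(Inl u, Inl v) | u v. (u, v) \<in> parcs H}
            \<union> {(Inr u, Inr v) | u v. (u, v) \<in> parcs K}
            \<union> {(Inl u, Inr v) | u v. u \<in> pverts H \<and> v \<in> pverts K}
            \<union> {(Inr v, Inl u) | u v. u \<in> pverts H \<and> v \<in> pverts K} \<rparr>"

text \<open>\<open>K\<^sub>1 \<or> m K\<^sub>2\<close>, with \<open>K\<^sub>1\<close> on the type \<open>unit\<close> and \<open>K\<^sub>2\<close> on the type \<open>bool\<close>.\<close>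

definition friendship_graph :: "nat \<Rightarrow> (unit + nat \<times> bool) pair_pre_digraph" where
  "friendship_graph m =
    graph_join (complete_graph_on UNIV) (disjoint_copies m (complete_graph_on UNIV))"

definition is_friendship_graph :: "'a pair_pre_digraph \<Rightarrow> bool" where
  "is_friendship_graph H \<longleftrightarrow>
    (\<exists>m\<ge>1. digraph_iso (with_proj H) (with_proj (friendship_graph m)))"

lemma pair_graph_power_graph:
  assumes "finite (carrier G)"
  shows "pair_graph (power_graph G)"
proof
  show "finite (parcs (power_graph G))"
    by (rule finite_subset[of _ "carrier G \<times> carrier G"])
       (use assms in \<open>auto simp: power_graph_def\<close>)
qed (use assms in \<open>auto simp: power_graph_def symmetric_def sym_def\<close>)

lemma pair_graph_friendship_graph: "pair_graph (friendship_graph m)"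
proof
  let ?V = "pverts (friendship_graph m)"
  show fin: "finite ?V"
    by (simp add: friendship_graph_def graph_join_def disjoint_copies_def complete_graph_on_def)
  show "finite (parcs (friendship_graph m))"
    by (rule finite_subset[of _ "?V \<times> ?V"])
       (use fin in \<open>auto simp: friendship_graph_def graph_join_def disjoint_copies_def
          complete_graph_on_def\<close>)
qed (auto simp: friendship_graph_def graph_join_def disjoint_copies_def complete_graph_on_def
      symmetric_def sym_def)

end

theory Submission
  imports Defs "HOL-Algebra.Multiplicative_Group" "HOL-Computational_Algebra.Primes"
begin

text \<open>
  Both sides say that \<open>G\<close> is nontrivial and that every element has order dividing \<open>3\<close>.

  For the power graph this is \<open>power_graph_friendship_iff_exponent_3\<close>. In a friendship graph every
  edge lies in exactly one triangle. In a power graph the identity is adjacent to every other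
  vertex, and any two distinct elements of \<open>\<langle>y\<rangle>\<close> one of which is \<open>y\<close> or \<open>\<one>\<close> are adjacent. So for
  \<open>y \<noteq> \<one>\<close> the edge \<open>{\<one>, y}\<close> is completed to a triangle by every further element of \<open>\<langle>y\<rangle>\<close>, and
  uniqueness forces \<open>\<bar>\<langle>y\<rangle>\<bar> \<le> 3\<close>. Existence of a triangle \<open>{\<one>, x, w}\<close> puts \<open>x\<close> and \<open>w\<close> into a
  common cyclic subgroup, which then has order exactly \<open>3\<close>; this is what excludes involutions.
  Using triangles rather than the centre of the graph spares the case of \<open>F\<^sub>1 = K\<^sub>3\<close>, in which
  the centre is not unique.
  Conversely, if every \<open>x \<noteq> \<one>\<close> has order \<open>3\<close>, then \<open>\<langle>x\<rangle> = {\<one>, x, x\<inverse>}\<close>, so the identity is joined to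
  everything and the only other edges are the disjoint pairs \<open>{x, x\<inverse>}\<close>.

  For the algebraic side, a finite abelian group of prime exponent \<open>p\<close> is a power of \<open>\<int>\<^sub>p\<close>
  (\<open>elementary_abelian_iso_product\<close>). Every tuple \<open>b\<^sub>0, \<dots>, b\<^sub>n\<^sub>-\<^sub>1\<close> yields a homomorphism
  \<open>a \<mapsto> \<Prod> b\<^sub>i\<^bsup>a\<^sub>i\<^esup>\<close> from \<open>\<int>\<^sub>p\<^sup>n\<close> to \<open>G\<close>. If it is injective and not surjective, any element
  outside its image prolongs the tuple and keeps injectivity
  (\<open>inj_power_product_extend\<close>), so a longest tuple with injective homomorphism gives an isomorphism.
\<close>

section \<open>Isomorphisms of simple graphs and triangles in friendship graphs\<close>

text \<open>
  Isomorphisms of general digraphs carry separate maps on arcs. For graphs without parallel arcs the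
  arc map is determined by the vertex map, which gives the elementary notion of isomorphism.
\<close>

lemma digraph_iso_with_proj_iff:
  assumes "pair_wf_digraph H" and "pair_wf_digraph K"
  shows "digraph_iso (with_proj H) (with_proj K) \<longleftrightarrow>
    (\<exists>f. bij_betw f (pverts H) (pverts K) \<and>
         (\<forall>u\<in>pverts H. \<forall>v\<in>pverts H. (u, v) \<in> parcs H \<longleftrightarrow> (f u, f v) \<in> parcs K))"
    (is "?iso \<longleftrightarrow> (\<exists>f. ?bij f \<and> ?arcs f)")
proof
  interpret H: pair_wf_digraph H by fact
  assume ?iso
  then obtain h where h: "H.digraph_isomorphism h" and K: "with_proj K = app_iso h (with_proj H)"
    unfolding digraph_iso_def by auto
  have "pverts K = iso_verts h ` pverts H"
    using arg_cong[OF K, of verts] by simp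
  then have bij: "?bij (iso_verts h)"
    using H.digraph_isomorphism_inj_on_verts[OF h] by (simp add: bij_betw_def)
  have parcs: "parcs K = (\<lambda>(u, v). (iso_verts h u, iso_verts h v)) ` parcs H"
    using arg_cong[OF K, of arcs_ends] H.arcs_ends_app_iso_eq[OF h] by simp
  have "?arcs (iso_verts h)"
  proof (intro ballI iffI)
    fix u v assume uv: "u \<in> pverts H" "v \<in> pverts H"
    show "(iso_verts h u, iso_verts h v) \<in> parcs K" if "(u, v) \<in> parcs H"
      using that parcs by force
    assume "(iso_verts h u, iso_verts h v) \<in> parcs K"
    then obtain u' v' where *: "(u', v') \<in> parcs H"
      "iso_verts h u = iso_verts h u'" "iso_verts h v = iso_verts h v'"
      using parcs by auto
    moreover have "u' \<in> pverts H" "v' \<in> pverts H"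
      using H.in_arcsD1[OF *(1)] H.in_arcsD2[OF *(1)] by auto
    ultimately show "(u, v) \<in> parcs H"
      using bij uv by (metis bij_betw_def inj_onD)
  qed
  with bij show "\<exists>f. ?bij f \<and> ?arcs f" by blast
next
  interpret H: pair_wf_digraph H by fact
  interpret K: pair_wf_digraph K by fact
  assume "\<exists>f. ?bij f \<and> ?arcs f"
  then obtain f where bij: "?bij f" and arcs: "?arcs f" by blast
  have inj: "inj_on f (pverts H)" and img: "f ` pverts H = pverts K"
    using bij by (auto simp: bij_betw_def)
  define h where "h = \<lparr> iso_verts = f, iso_arcs = map_prod f f, iso_head = snd, iso_tail = fst \<rparr>"
  have parcs_sub: "parcs H \<subseteq> pverts H \<times> pverts H"
    by (auto dest: H.in_arcsD1 H.in_arcsD2)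
  have "inj_on (map_prod f f) (parcs H)"
    by (rule inj_on_subset[OF map_prod_inj_on[OF inj inj] parcs_sub])
  then have "H.digraph_isomorphism h"
    using inj by (simp add: H.digraph_isomorphism_def h_def H.wf_digraph_axioms)
  moreover have "parcs K = map_prod f f ` parcs H"
  proof (intro equalityI subsetI)
    fix e assume e: "e \<in> parcs K"
    obtain a b where ab: "e = (a, b)" by (cases e)
    then have "a \<in> f ` pverts H" "b \<in> f ` pverts H"
      using e img K.in_arcsD1 K.in_arcsD2 by auto
    then obtain u v where "e = (f u, f v)" "u \<in> pverts H" "v \<in> pverts H"
      using ab by blast
    then show "e \<in> map_prod f f ` parcs H"
      using e arcs by force
  next
    fix e assume "e \<in> map_prod f f ` parcs H"
    then show "e \<in> parcs K" using arcs parcs_sub by fastforce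
  qed
  then have "with_proj K = app_iso h (with_proj H)"
    using img by (simp add: app_iso_def with_proj_def h_def)
  ultimately show ?iso
    unfolding digraph_iso_def by blast
qed

lemma pair_graph_imp_pair_wf_digraph:
  assumes "pair_graph H"
  shows "pair_wf_digraph H"
proof -
  interpret pair_graph H by fact
  show ?thesis ..
qed

lemma is_friendship_graph_iff:
  assumes "pair_graph H"
  shows "is_friendship_graph H \<longleftrightarrow>
    (\<exists>m\<ge>1. \<exists>f. bij_betw f (pverts H) (pverts (friendship_graph m)) \<and>
       (\<forall>u\<in>pverts H. \<forall>v\<in>pverts H. (u, v) \<in> parcs H \<longleftrightarrow> (f u, f v) \<in> parcs (friendship_graph m)))"
proof -
  have "pair_wf_digraph (friendship_graph m)" for m
    by (intro pair_graph_imp_pair_wf_digraph pair_graph_friendship_graph)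
  then show ?thesis
    using pair_graph_imp_pair_wf_digraph[OF assms]
    by (simp only: is_friendship_graph_def digraph_iso_with_proj_iff)
qed

lemma pverts_friendship_graph:
  "pverts (friendship_graph m) = insert (Inl ()) (Inr ` ({..<m} \<times> UNIV))"
  by (auto simp: friendship_graph_def graph_join_def disjoint_copies_def complete_graph_on_def)

lemma parcs_friendship_graph:
  "(u, v) \<in> parcs (friendship_graph m) \<longleftrightarrow>
    (case (u, v) of
       (Inl _, Inl _) \<Rightarrow> False
     | (Inl _, Inr (j, _)) \<Rightarrow> j < m
     | (Inr (i, _), Inl _) \<Rightarrow> i < m
     | (Inr (i, a), Inr (j, b)) \<Rightarrow> i < m \<and> j = i \<and> a \<noteq> b)"
  by (cases u; cases v)
     (simp_all add: friendship_graph_def graph_join_def disjoint_copies_def complete_graph_on_def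
       split_beta, auto)

text \<open>
  The third vertex of the triangle through a blade edge is the centre, and through an edge at the
  centre it is the other end of the same blade.
\<close>

lemma friendship_graph_arc_in_unique_triangle:
  assumes "(u, v) \<in> parcs (friendship_graph m)"
  shows "\<exists>!w. (u, w) \<in> parcs (friendship_graph m) \<and> (v, w) \<in> parcs (friendship_graph m)"
proof (cases u)
  case (Inl x)
  then obtain i a where v: "v = Inr (i, a)" "i < m"
    using assms by (auto simp: parcs_friendship_graph split: sum.splits)
  show ?thesis
    by (rule ex1I[of _ "Inr (i, \<not> a)"])
       (use Inl v in \<open>auto simp: parcs_friendship_graph split: sum.splits\<close>)
next
  case (Inr ia)
  then obtain i a where u: "u = Inr (i, a)" "i < m"
    using assms by (cases ia) (auto simp: parcs_friendship_graph split: sum.splits)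
  show ?thesis
  proof (cases v)
    case (Inl x)
    show ?thesis
      by (rule ex1I[of _ "Inr (i, \<not> a)"])
         (use Inl u in \<open>auto simp: parcs_friendship_graph split: sum.splits\<close>)
  next
    case (Inr jb)
    then have v: "v = Inr (i, \<not> a)"
      using assms u by (cases jb) (auto simp: parcs_friendship_graph)
    show ?thesis
      by (rule ex1I[of _ "Inl ()"])
         (use v u in \<open>auto simp: parcs_friendship_graph split: sum.splits\<close>)
  qed
qed

section \<open>Power graphs that are friendship graphs\<close>

lemma pverts_power_graph [simp]: "pverts (power_graph G) = carrier G"
  by (simp add: power_graph_def)

context group
begin

lemma generate_singleton_of_cube_eq_one:
  assumes x: "x \<in> carrier G" and cube: "x [^] (3::nat) = \<one>"
  shows "generate G {x} = {\<one>, x, inv x}"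
proof
  have "\<one> \<in> generate G {x}" "x \<in> generate G {x}" "inv x \<in> generate G {x}"
    by (auto intro: generate.one generate.incl generate.inv)
  then show "{\<one>, x, inv x} \<subseteq> generate G {x}" by simp
  have "ord x dvd 3"
    using x cube pow_eq_id by blast
  then have pos: "ord x \<noteq> 0"
    by (metis dvd_0_left_iff zero_neq_numeral)
  have inv: "inv x = x [^] (2::nat)"
    using x cube by (intro inv_equality) (simp_all add: numeral_eq_Suc)
  show "generate G {x} \<subseteq> {\<one>, x, inv x}"
  proof
    fix y assume "y \<in> generate G {x}"
    then obtain k where "y = x [^] (k::nat)"
      using generate_pow_nat[OF x pos] by auto
    then have "y = x [^] (k mod 3)"
      using x cube
      by (metis mod_mult_div_eq nat_pow_closed nat_pow_mult nat_pow_one nat_pow_pow r_one)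
    moreover have "k mod 3 \<in> {0, 1, 2}" by auto
    ultimately show "y \<in> {\<one>, x, inv x}"
      using x inv by auto
  qed
qed

lemma pow_card_generate_eq_one:
  assumes "x \<in> carrier G" "y \<in> generate G {x}"
  shows "y [^] card (generate G {x}) = \<one>"
proof -
  obtain k where "y = x [^] (k::int)"
    using assms generate_pow by auto
  then have "y [^] int (ord x) = \<one>"
    using assms(1)
    by (metis int_pow_closed int_pow_int int_pow_one int_pow_pow mult.commute pow_ord_eq_1)
  then show ?thesis
    using generate_pow_card[OF assms(1)] by (simp add: int_pow_int)
qed

text \<open>
  The isomorphism only serves to transport the property that every edge lies in exactly one
  triangle; the rest of the argument takes place in the power graph.
\<close>

lemma cube_eq_one_if_power_graph_friendship:
  assumes fin: "finite (carrier G)" and fr: "is_friendship_graph (power_graph G)"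
    and x: "x \<in> carrier G"
  shows "x [^] (3::nat) = \<one>"
proof (cases "x = \<one>")
  case False
  let ?adj = "\<lambda>u v. (u, v) \<in> parcs (power_graph G)"
  have adj: "?adj u v \<longleftrightarrow> u \<in> carrier G \<and> v \<in> carrier G \<and> u \<noteq> v \<and>
      (u \<in> generate G {v} \<or> v \<in> generate G {u})" for u v
    by (simp add: power_graph_def)
  obtain m f where bij: "bij_betw f (carrier G) (pverts (friendship_graph m))"
    and arcs: "\<And>u v. u \<in> carrier G \<Longrightarrow> v \<in> carrier G \<Longrightarrow>
      ?adj u v \<longleftrightarrow> (f u, f v) \<in> parcs (friendship_graph m)"
    using fr is_friendship_graph_iff[OF pair_graph_power_graph[OF fin]] by auto
  interpret F: pair_graph "friendship_graph m" by (rule pair_graph_friendship_graph)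
  have triangle: "\<exists>!w. ?adj u w \<and> ?adj v w" if "?adj u v" for u v
  proof -
    have uv: "u \<in> carrier G" "v \<in> carrier G" using that adj by auto
    have "(f u, f v) \<in> parcs (friendship_graph m)" using that uv arcs by blast
    then obtain z where z: "(f u, z) \<in> parcs (friendship_graph m)"
        "(f v, z) \<in> parcs (friendship_graph m)"
      and uniq: "\<And>z'. (f u, z') \<in> parcs (friendship_graph m) \<Longrightarrow>
        (f v, z') \<in> parcs (friendship_graph m) \<Longrightarrow> z' = z"
      using friendship_graph_arc_in_unique_triangle by metis
    have "z \<in> f ` carrier G"
      using F.in_arcsD2[OF z(1)] bij by (simp add: bij_betw_def)
    then obtain w where w: "w \<in> carrier G" "z = f w" by auto
    show ?thesis
    proof (rule ex1I[of _ w])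
      show "?adj u w \<and> ?adj v w" using z w uv arcs by simp
      fix w' assume w': "?adj u w' \<and> ?adj v w'"
      then have "w' \<in> carrier G" using adj by auto
      then have "f w' = f w" using uniq w' uv arcs w by auto
      then show "w' = w"
        using bij \<open>w' \<in> carrier G\<close> w by (metis bij_betw_def inj_onD)
    qed
  qed
  \<comment> \<open>Each element of \<open>\<langle>y\<rangle>\<close> besides \<open>\<one>\<close> and \<open>y\<close> completes the edge \<open>{\<one>, y}\<close> to a triangle.\<close>
  have card_le: "card (generate G {y}) \<le> 3" if y: "y \<in> carrier G" "y \<noteq> \<one>" for y
  proof -
    have "?adj \<one> y" using y by (simp add: adj generate.one)
    then obtain w where uniq: "\<And>w'. ?adj \<one> w' \<and> ?adj y w' \<Longrightarrow> w' = w"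
      using triangle by metis
    have "generate G {y} \<subseteq> {\<one>, y, w}"
    proof
      fix z assume z: "z \<in> generate G {y}"
      then have "z \<in> carrier G"
        using generate_in_carrier[of "{y}" z] y(1) by simp
      then show "z \<in> {\<one>, y, w}"
        using uniq[of z] z y by (auto simp: adj generate.one)
    qed
    then have "card (generate G {y}) \<le> card {\<one>, y, w}"
      by (intro card_mono) auto
    also have "\<dots> \<le> 3" by (simp add: card_insert_if)
    finally show ?thesis .
  qed
  have "?adj \<one> x" using False x by (simp add: adj generate.one)
  then obtain w where w: "?adj \<one> w" "?adj x w"
    using triangle by metis
  \<comment> \<open>Take for \<open>y\<close> whichever of the adjacent elements \<open>x\<close>, \<open>w\<close> generates the other.\<close>
  then obtain y where y: "y \<in> {x, w}" "{\<one>, x, w} \<subseteq> generate G {y}"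
    unfolding adj by (auto intro: generate.one generate.incl)
  then have yc: "y \<in> carrier G" "y \<noteq> \<one>"
    using w x False by (auto simp: adj)
  have "finite (generate G {y})"
    using generate_incl[of "{y}"] yc(1) fin by (auto intro: finite_subset)
  then have "card {\<one>, x, w} \<le> card (generate G {y})"
    using y(2) by (intro card_mono)
  moreover have "card {\<one>, x, w} = 3"
    using w False by (auto simp: adj)
  ultimately have "card (generate G {y}) = 3"
    using card_le[OF yc] by simp
  moreover have "x [^] card (generate G {y}) = \<one>"
    using yc(1) y(2) by (intro pow_card_generate_eq_one) auto
  ultimately show ?thesis by simp
qed simp

text \<open>
  Inversion has no fixed point besides \<open>\<one>\<close>, so the other elements split into pairs \<open>{x, x\<inverse>}\<close>. These
  become the blades: number the pairs, choose a representative in each, and send the representative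
  to the end \<open>True\<close> of its blade and its inverse to the end \<open>False\<close>.
\<close>

lemma power_graph_friendship_if_cube_eq_one:
  assumes fin: "finite (carrier G)" and nontriv: "carrier G \<noteq> {\<one>}"
    and cube: "\<And>x. x \<in> carrier G \<Longrightarrow> x [^] (3::nat) = \<one>"
  shows "is_friendship_graph (power_graph G)"
proof -
  let ?C = "carrier G - {\<one>}"
  have inv_ne: "inv x \<noteq> x" if "x \<in> ?C" for x
  proof
    assume "inv x = x"
    then have "x \<otimes> x = \<one>" using that by (metis Diff_iff r_inv)
    then have "x = \<one>" using cube[of x] that by (simp add: numeral_eq_Suc)
    then show False using that by simp
  qed
  have invC: "inv x \<in> ?C" if "x \<in> ?C" for x
    using that by auto
  define pair where "pair x = {x, inv x}" for x
  define P where "P = pair ` ?C"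
  have finP: "finite P" using fin by (simp add: P_def)
  define m where "m = card P"
  have "?C \<noteq> {}" using nontriv by auto
  then have "P \<noteq> {}" by (simp add: P_def)
  then have m: "m \<ge> 1" using finP by (simp add: m_def Suc_leI card_gt_0_iff)
  obtain h where h: "bij_betw h P {..<m}"
    using ex_bij_betw_finite_nat[OF finP] by (auto simp: m_def atLeast0LessThan)
  have pair_eq: "pair x = pair y \<longleftrightarrow> y = x \<or> y = inv x" if "x \<in> ?C" "y \<in> ?C" for x y
    using that by (auto simp: pair_def doubleton_eq_iff)
  define rep where "rep S = (SOME x. x \<in> S)" for S :: "'a set"
  have rep: "rep (pair x) = x \<or> rep (pair x) = inv x" for x
    unfolding rep_def pair_def using someI[of "\<lambda>y. y \<in> {x, inv x}" x] by auto
  define f where "f x = (if x = \<one> then Inl () else Inr (h (pair x), x = rep (pair x)))" for x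
  have h_eq: "h (pair x) = h (pair y) \<longleftrightarrow> pair x = pair y" if "x \<in> ?C" "y \<in> ?C" for x y
    using h that by (auto simp: bij_betw_def P_def inj_on_def)
  have h_less: "h (pair x) < m" if "x \<in> ?C" for x
    using h that by (auto simp: bij_betw_def P_def)
  have rep_inv: "inv x = rep (pair (inv x)) \<longleftrightarrow> x \<noteq> rep (pair x)" if "x \<in> ?C" for x
    using rep[of x] inv_ne[OF that] pair_eq[OF that invC[OF that]] by auto
  have bij: "bij_betw f (carrier G) (pverts (friendship_graph m))"
    unfolding bij_betw_def
  proof
    show "inj_on f (carrier G)"
    proof (rule inj_onI)
      fix x y assume xy: "x \<in> carrier G" "y \<in> carrier G" "f x = f y"
      show "x = y"
      proof (cases "x = \<one> \<or> y = \<one>")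
        case True
        then show ?thesis using xy(3) by (auto simp: f_def split: if_splits)
      next
        case False
        then have C: "x \<in> ?C" "y \<in> ?C" using xy by auto
        have "h (pair x) = h (pair y)" and r: "x = rep (pair x) \<longleftrightarrow> y = rep (pair y)"
          using xy(3) False by (auto simp: f_def)
        then have "y = x \<or> y = inv x"
          using h_eq[OF C] pair_eq[OF C] by simp
        then show ?thesis using r rep_inv[OF C(1)] by auto
      qed
    qed
    show "f ` carrier G = pverts (friendship_graph m)"
    proof (intro equalityI subsetI)
      fix z assume "z \<in> f ` carrier G"
      then show "z \<in> pverts (friendship_graph m)"
        using h_less by (auto simp: f_def pverts_friendship_graph)
    next
      fix z assume "z \<in> pverts (friendship_graph m)"
      then consider "z = Inl ()" | i b where "z = Inr (i, b)" "i < m"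
        by (auto simp: pverts_friendship_graph)
      then show "z \<in> f ` carrier G"
      proof cases
        case 1
        then have "z = f \<one>" by (simp add: f_def)
        then show ?thesis by simp
      next
        case 2
        then have "i \<in> h ` pair ` ?C"
          using h by (simp add: bij_betw_def P_def)
        then obtain x where x: "x \<in> ?C" "h (pair x) = i" by blast
        have "h (pair (inv x)) = i"
          using x pair_eq[OF x(1) invC[OF x(1)]] by simp
        then have "z = f x \<or> z = f (inv x)"
          using 2 x rep_inv[OF x(1)] invC[OF x(1)] by (auto simp: f_def)
        then show ?thesis using x(1) by auto
      qed
    qed
  qed
  moreover have "(x, y) \<in> parcs (power_graph G) \<longleftrightarrow> (f x, f y) \<in> parcs (friendship_graph m)"
    if x: "x \<in> carrier G" and y: "y \<in> carrier G" for x y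
  proof -
    have gen: "generate G {z} = {\<one>, z, inv z}" if "z \<in> carrier G" for z
      using that cube by (intro generate_singleton_of_cube_eq_one)
    have adj: "(x, y) \<in> parcs (power_graph G) \<longleftrightarrow>
        x \<noteq> y \<and> (x \<in> {\<one>, y, inv y} \<or> y \<in> {\<one>, x, inv x})"
      using x y by (simp add: power_graph_def gen)
    show ?thesis
    proof (cases "x = \<one> \<or> y = \<one>")
      case True
      then show ?thesis
        using x y h_less[of x] h_less[of y]
        by (auto simp: adj f_def parcs_friendship_graph)
    next
      case False
      then have C: "x \<in> ?C" "y \<in> ?C" using x y by auto
      have "(f x, f y) \<in> parcs (friendship_graph m) \<longleftrightarrow>
          pair x = pair y \<and> (x = rep (pair x)) \<noteq> (y = rep (pair y))"
        using False h_less[OF C(1)] h_eq[OF C(2) C(1)] by (auto simp: f_def parcs_friendship_graph)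
      also have "\<dots> \<longleftrightarrow> y = inv x"
        using pair_eq[OF C] rep_inv[OF C(1)] by auto
      also have "\<dots> \<longleftrightarrow> (x, y) \<in> parcs (power_graph G)"
        using False x y inv_ne[OF C(1)] by (auto simp: adj)
      finally show ?thesis by simp
    qed
  qed
  ultimately show ?thesis
    using is_friendship_graph_iff[OF pair_graph_power_graph[OF fin]] m by auto
qed

theorem power_graph_friendship_iff_exponent_3:
  assumes fin: "finite (carrier G)"
  shows "is_friendship_graph (power_graph G) \<longleftrightarrow>
    carrier G \<noteq> {\<one>} \<and> (\<forall>x\<in>carrier G. x [^] (3::nat) = \<one>)"
proof
  assume fr: "is_friendship_graph (power_graph G)"
  then obtain m f where "m \<ge> 1" and bij: "bij_betw f (carrier G) (pverts (friendship_graph m))"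
    unfolding is_friendship_graph_iff[OF pair_graph_power_graph[OF fin]] pverts_power_graph by blast
  then have "Inl () \<in> f ` carrier G" "Inr (0, True) \<in> f ` carrier G"
    by (auto simp: bij_betw_def pverts_friendship_graph)
  then have "carrier G \<noteq> {\<one>}" by (metis Inl_Inr_False imageE singletonD)
  then show "carrier G \<noteq> {\<one>} \<and> (\<forall>x\<in>carrier G. x [^] (3::nat) = \<one>)"
    using cube_eq_one_if_power_graph_friendship[OF fin fr] by blast
qed (use power_graph_friendship_if_cube_eq_one[OF fin] in blast)

end

section \<open>Elementary abelian groups\<close>

lemma (in group) int_pow_mod_eq:
  assumes x: "x \<in> carrier G" and "x [^] (p::nat) = \<one>"
  shows "x [^] (k mod int p) = x [^] k"
proof -
  have "x [^] (int p * (k div int p)) = \<one>"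
    using assms by (metis int_pow_int int_pow_one int_pow_pow)
  then have "x [^] (int p * (k div int p) + k mod int p) = x [^] (k mod int p)"
    using x int_pow_mult[OF x, of "int p * (k div int p)" "k mod int p"] by simp
  then show ?thesis by simp
qed

context comm_group
begin

definition power_product :: "nat \<Rightarrow> (nat \<Rightarrow> 'a) \<Rightarrow> (nat \<Rightarrow> int) \<Rightarrow> 'a" where
  "power_product n b a = (\<Otimes>i\<in>{..<n}. b i [^] a i)"

lemma power_product_closed [simp]:
  "b \<in> {..<n} \<rightarrow> carrier G \<Longrightarrow> power_product n b a \<in> carrier G"
  unfolding power_product_def by (intro finprod_closed) auto

lemma power_product_Suc:
  assumes "b \<in> {..<Suc n} \<rightarrow> carrier G"
  shows "power_product (Suc n) b a = b n [^] a n \<otimes> power_product n b a"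
  unfolding power_product_def lessThan_Suc
proof (rule finprod_insert)
  show "(\<lambda>i. b i [^] a i) \<in> {..<n} \<rightarrow> carrier G"
    using assms by (simp add: Pi_iff)
  show "b n [^] a n \<in> carrier G"
    using assms by (simp add: Pi_iff)
qed simp_all

lemma power_product_cong:
  assumes "c \<in> {..<n} \<rightarrow> carrier G"
    and "\<And>i. i < n \<Longrightarrow> b i = c i" "\<And>i. i < n \<Longrightarrow> a i = a' i"
  shows "power_product n b a = power_product n c a'"
  unfolding power_product_def
proof (rule finprod_cong')
  show "(\<lambda>i. c i [^] a' i) \<in> {..<n} \<rightarrow> carrier G"
    using assms(1) by (simp add: Pi_iff)
  show "b i [^] a i = c i [^] a' i" if "i \<in> {..<n}" for i
    using that assms(2,3) by simp
qed simp

text \<open>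
  The exponents are representatives in \<open>{0..<p}\<close> and add modulo \<open>p\<close>; the reduction does not change
  the powers since \<open>p\<close> is an exponent of the group.
\<close>

lemma power_product_hom:
  assumes b: "b \<in> {..<n} \<rightarrow> carrier G" and exp: "\<And>x. x \<in> carrier G \<Longrightarrow> x [^] (p::nat) = \<one>"
  shows "power_product n b \<in> hom (product_group {..<n} (\<lambda>_. integer_mod_group p)) G"
proof (rule homI)
  fix a c :: "nat \<Rightarrow> int"
  have "power_product n b (\<lambda>i\<in>{..<n}. (a i + c i) mod int p) =
      (\<Otimes>i\<in>{..<n}. b i [^] a i \<otimes> b i [^] c i)"
    unfolding power_product_def
  proof (intro finprod_cong')
    fix i assume "i \<in> {..<n}"
    then show "b i [^] (\<lambda>i\<in>{..<n}. (a i + c i) mod int p) i = b i [^] a i \<otimes> b i [^] c i"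
      using b exp int_pow_mod_eq by (auto simp: int_pow_mult[symmetric] Pi_iff)
  qed (use b in auto)
  also have "\<dots> = power_product n b a \<otimes> power_product n b c"
    unfolding power_product_def using b by (intro finprod_multf) auto
  finally show "power_product n b (a \<otimes>\<^bsub>product_group {..<n} (\<lambda>_. integer_mod_group p)\<^esub> c) =
      power_product n b a \<otimes> power_product n b c"
    by simp
qed (use b in simp)

text \<open>
  Suppose \<open>x\<^bsup>k\<^esup>\<close> times an element of the image \<open>H\<close> of \<open>power_product n b\<close> is \<open>\<one>\<close>, with \<open>0 < k < p\<close>. Then
  \<open>x\<^bsup>k\<^esup> \<in> H\<close>, and as \<open>k\<close> is invertible modulo \<open>p\<close> even \<open>x \<in> H\<close>. So an element \<open>x\<close> outside \<open>H\<close> can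
  only occur with exponent \<open>0\<close> in a kernel element, which then is trivial by injectivity for \<open>b\<close>.
\<close>

lemma inj_power_product_extend:
  assumes p: "prime p" and exp: "\<And>x. x \<in> carrier G \<Longrightarrow> x [^] (p::nat) = \<one>"
    and b: "b \<in> {..<n} \<rightarrow> carrier G"
    and inj: "inj_on (power_product n b) (carrier (product_group {..<n} (\<lambda>_. integer_mod_group p)))"
    and x: "x \<in> carrier G"
      "x \<notin> power_product n b ` carrier (product_group {..<n} (\<lambda>_. integer_mod_group p))"
  shows "inj_on (power_product (Suc n) (b(n := x)))
    (carrier (product_group {..<Suc n} (\<lambda>_. integer_mod_group p)))"
proof -
  let ?Z = "\<lambda>n. product_group {..<n} (\<lambda>_. integer_mod_group p)"
  let ?b = "b(n := x)"
  have p0: "p \<noteq> 0" using p by auto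
  have b': "?b \<in> {..<Suc n} \<rightarrow> carrier G" using b x by (auto simp: less_Suc_eq)
  interpret H: group_hom "?Z n" G "power_product n b"
    using power_product_hom[OF b exp] by (intro group_hom.intro group_hom_axioms.intro) (simp_all add: is_group)
  interpret H': group_hom "?Z (Suc n)" G "power_product (Suc n) ?b"
    using power_product_hom[OF b' exp] by (intro group_hom.intro group_hom_axioms.intro) (simp_all add: is_group)
  interpret S: subgroup "power_product n b ` carrier (?Z n)" G
    by (rule H.img_is_subgroup)
  show ?thesis
    unfolding H'.inj_on_one_iff
  proof (intro allI impI)
    fix a assume a: "a \<in> carrier (?Z (Suc n))" and eq: "power_product (Suc n) ?b a = \<one>"
    define a' where "a' = restrict a {..<n}"
    have a': "a' \<in> carrier (?Z n)" using a by (simp add: a'_def PiE_iff)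
    have range: "0 \<le> a n" "a n < int p"
      using a p0 by (auto simp: carrier_integer_mod_group PiE_iff)
    have "power_product n ?b a = power_product n b a'"
      using b by (intro power_product_cong) (auto simp: a'_def)
    then have prod: "x [^] a n \<otimes> power_product n b a' = \<one>"
      using eq power_product_Suc[OF b'] by simp
    have an: "a n = 0"
    proof (rule ccontr)
      assume "a n \<noteq> 0"
      then have "\<not> int p dvd a n"
        using range by (auto dest: zdvd_imp_le)
      then have "coprime (int p) (a n)"
        using p by (intro prime_imp_coprime) auto
      then obtain u v where uv: "u * a n + v * int p = 1"
        using bezout_int[of "a n" "int p"] by (auto simp: coprime_iff_gcd_eq_1 gcd.commute)
      have "x [^] a n = inv (power_product n b a')"
        using prod x(1) b by (metis int_pow_closed inv_equality power_product_closed)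
      then have "x [^] a n \<in> power_product n b ` carrier (?Z n)"
        using a' by (simp only: S.m_inv_closed imageI)
      then have "(x [^] a n) [^] u \<in> power_product n b ` carrier (?Z n)"
        using subgroup_int_pow_closed[OF H.img_is_subgroup] by blast
      moreover have "(x [^] a n) [^] u = x"
      proof -
        have "x = x [^] (u * a n + v * int p)" using x(1) uv by simp
        also have "\<dots> = x [^] (a n * u) \<otimes> x [^] (int p * v)"
          using x(1) by (simp add: int_pow_mult mult.commute)
        also have "x [^] (int p * v) = \<one>"
          using x(1) exp by (metis int_pow_int int_pow_one int_pow_pow)
        finally show ?thesis using x(1) by (simp add: int_pow_pow)
      qed
      ultimately show False using x(2) by simp
    qed
    then have "power_product n b a' = \<one>" using prod b by simp
    then have "a' = \<one>\<^bsub>?Z n\<^esub>"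
      using inj a' H.inj_on_one_iff by blast
    then have "a i = 0" if "i < n" for i
      using that by (metis (mono_tags, lifting) a'_def lessThan_iff one_integer_mod_group one_product_group restrict_apply')
    then show "a = \<one>\<^bsub>?Z (Suc n)\<^esub>"
      using a an by (auto simp: PiE_iff extensional_def fun_eq_iff less_Suc_eq)
  qed
qed

theorem elementary_abelian_iso_product:
  assumes fin: "finite (carrier G)" and p: "prime p"
    and exp: "\<And>x. x \<in> carrier G \<Longrightarrow> x [^] (p::nat) = \<one>"
  shows "\<exists>n::nat. G \<cong> product_group {..<n} (\<lambda>_. integer_mod_group p)"
proof -
  let ?Z = "\<lambda>n::nat. product_group {..<n} (\<lambda>_. integer_mod_group p)"
  define P where "P n \<longleftrightarrow> (\<exists>b. b \<in> {..<n} \<rightarrow> carrier G \<and> inj_on (power_product n b) (carrier (?Z n)))" for n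
  have "P 0"
    by (auto simp: P_def)
  \<comment> \<open>\<open>n < p\<^sup>n\<close>, and injectivity gives \<open>p\<^sup>n \<le> \<bar>G\<bar>\<close>; so a greatest \<open>n\<close> exists.\<close>
  moreover have "\<forall>n. P n \<longrightarrow> n < card (carrier G)"
  proof (intro allI impI)
    fix n assume "P n"
    then obtain b where b: "b \<in> {..<n} \<rightarrow> carrier G" "inj_on (power_product n b) (carrier (?Z n))"
      by (auto simp: P_def)
    have "n < 2 ^ n" by (rule less_exp)
    also have "(2::nat) ^ n \<le> p ^ n"
      using prime_ge_2_nat[OF p] by (rule power_mono) simp
    also have "p ^ n = card (carrier (?Z n))"
      using p by (auto simp: card_PiE carrier_integer_mod_group)
    also have "\<dots> \<le> card (carrier G)"
      using b by (intro card_inj_on_le[OF b(2) _ fin]) auto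
    finally show "n < card (carrier G)" by simp
  qed
  ultimately obtain n where n: "P n" and max: "\<And>k. P k \<Longrightarrow> k \<le> n"
    using ex_has_greatest_nat[of P 0 "\<lambda>n. n" "card (carrier G)"] by blast
  from n obtain b where b: "b \<in> {..<n} \<rightarrow> carrier G"
    and inj: "inj_on (power_product n b) (carrier (?Z n))"
    unfolding P_def by blast
  have "carrier G \<subseteq> power_product n b ` carrier (?Z n)"
  proof (rule ccontr)
    assume "\<not> ?thesis"
    then obtain x where x: "x \<in> carrier G" "x \<notin> power_product n b ` carrier (?Z n)"
      by blast
    have "b(n := x) \<in> {..<Suc n} \<rightarrow> carrier G"
      using b x by (auto simp: less_Suc_eq)
    then have "P (Suc n)"
      using inj_power_product_extend[OF p exp b inj x] unfolding P_def by blast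
    then show False using max by force
  qed
  then have "power_product n b ` carrier (?Z n) = carrier G"
    using b by auto
  then have "power_product n b \<in> iso (?Z n) G"
    using power_product_hom[OF b exp] inj by (simp add: iso_iff)
  then have "?Z n \<cong> G" by (rule is_isoI)
  then show ?thesis
    using group.iso_sym[of "?Z n" G] by auto
qed

end

lemma iso_product_pow_eq_one:
  assumes "group G" and iso: "G \<cong> product_group I (\<lambda>_. integer_mod_group p)"
    and x: "x \<in> carrier G"
  shows "x [^]\<^bsub>G\<^esub> (p::nat) = \<one>\<^bsub>G\<^esub>"
proof -
  let ?Z = "product_group I (\<lambda>_. integer_mod_group p)"
  obtain h where h: "h \<in> iso G ?Z" using iso by (auto simp: is_iso_def)
  interpret G: group G by fact
  interpret Z: group ?Z by simp
  interpret h: group_hom G ?Z h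
    using h by (intro group_hom.intro group_hom_axioms.intro) (simp_all add: iso_def G.is_group)
  have pow: "(z [^]\<^bsub>?Z\<^esub> k) i = z i [^]\<^bsub>integer_mod_group p\<^esub> k"
    if "z \<in> carrier ?Z" "i \<in> I" for z i and k :: nat
    using that by (induction k) (auto simp: nat_pow_def)
  have "h (x [^]\<^bsub>G\<^esub> p) = h x [^]\<^bsub>?Z\<^esub> p"
    using x by (simp add: h.hom_nat_pow)
  also have "\<dots> = \<one>\<^bsub>?Z\<^esub>"
  proof (rule PiE_ext)
    show "h x [^]\<^bsub>?Z\<^esub> p \<in> (\<Pi>\<^sub>E i\<in>I. carrier (integer_mod_group p))"
      using Z.nat_pow_closed[OF h.hom_closed[OF x], of p] by simp
    show "\<one>\<^bsub>?Z\<^esub> \<in> (\<Pi>\<^sub>E i\<in>I. carrier (integer_mod_group p))"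
      using Z.one_closed by simp
    show "(h x [^]\<^bsub>?Z\<^esub> p) i = \<one>\<^bsub>?Z\<^esub> i" if "i \<in> I" for i
      using that x pow[OF h.hom_closed[OF x] that] by simp
  qed
  finally show ?thesis
    using h x h.iso_iff by simp
qed

theorem corollary3p1:
  fixes G :: "('a, 'b) monoid_scheme"
  assumes "comm_group G"
    and "finite (carrier G)"
  shows "is_friendship_graph (power_graph G) \<longleftrightarrow>
         (\<exists>n::nat. n > 0 \<and> G \<cong> product_group {..<n} (\<lambda>_. integer_mod_group 3))"
proof -
  interpret comm_group G by fact
  let ?Z = "\<lambda>n::nat. product_group {..<n} (\<lambda>_. integer_mod_group 3)"
  have trivial: "carrier G = {\<one>\<^bsub>G\<^esub>} \<longleftrightarrow> n = 0" if iso: "G \<cong> ?Z n" for n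
  proof -
    have "trivial_group G \<longleftrightarrow> trivial_group (?Z n)"
      using iso by (intro isomorphic_group_triviality) (simp_all add: is_group)
    moreover have "trivial_group (?Z n) \<longleftrightarrow> n = 0"
      by (subst trivial_product_group) (auto simp: trivial_integer_mod_group)
    ultimately show ?thesis
      by (auto simp: trivial_group_def is_group)
  qed
  show ?thesis
    unfolding power_graph_friendship_iff_exponent_3[OF assms(2)]
  proof
    assume *: "carrier G \<noteq> {\<one>\<^bsub>G\<^esub>} \<and> (\<forall>x\<in>carrier G. x [^]\<^bsub>G\<^esub> (3::nat) = \<one>\<^bsub>G\<^esub>)"
    have "prime (3::nat)" by simp
    then obtain n where "G \<cong> ?Z n"
      using elementary_abelian_iso_product[OF assms(2), of 3] * by auto
    then show "\<exists>n>0. G \<cong> ?Z n" using trivial * by auto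
  next
    assume "\<exists>n>0. G \<cong> ?Z n"
    then show "carrier G \<noteq> {\<one>\<^bsub>G\<^esub>} \<and> (\<forall>x\<in>carrier G. x [^]\<^bsub>G\<^esub> (3::nat) = \<one>\<^bsub>G\<^esub>)"
      using trivial iso_product_pow_eq_one[OF is_group] by blast
  qed
qed

end
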